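(* Let $\mu,\nu$ be Borel probability measures on $\mathbb{R}^d$ such that $\mu$ is absolutely continuous with respect to the Lebesgue measure and $$\int_{\mathbb{R}^d}|x|^2\,\mu(dx)+\int_{\mathbb{R}^d}|y|^2\,\nu(dy)<\infty .$$ Let $c(x,y)=|x-y|^2$ for $x,y\in\mathbb{R}^d$, and for Borel measurable $T:\mathbb{R}^d\to\mathbb{R}^d$ put $$M(T)=\int_{\mathbb{R}^d}|x-T(x)|^2\,\mu(dx)\in[0,\infty].$$ Let $K:\mathbb{R}^d\times\mathbb{R}^d\to\mathbb{R}$ be a bounded, continuous, symmetric and strictly positive definite kernel, and let $\gamma=\gamma_K$ be the associated maximum mean discrepancy on the set $\mathcal{P}(\mathbb{R}^d)$ of Borel probability measures on $\mathbb{R}^d$. Suppose that $\gamma$ metrizes the weak topology on $\mathcal{P}(\mathbb{R}^d)$. For $\lambda>0$ and Borel measurable $T:\mathbb{R}^d\to\mathbb{R}^d$ let $$M_\lambda(T)=M(T)+\lambda\,\gamma^2(\mu\circ T^{-1},\nu),\qquad M_\lambda^*=\inf_T M_\lambda(T),$$ the infimum being over all Borel measurable maps $T:\mathbb{R}^d\to\mathbb{R}^d$. Let $\{\varepsilon_n\}_{n=1}^\infty$ and $\{\lambda_n\}_{n=1}^\infty$ be arbitrary sequences of positive numbers with $\varepsilon_n\to0$ and $\lambda_n\to+\infty$ as $n\to\infty$, and for each $n$ let $T_n:\mathbb{R}^d\to\mathbb{R}^d$ be a Borel measurable map such that $$M_{\lambda_n}(T_n)-\varepsilon_n\le M_{\lambda_n}^*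 .$$ Then $$\lim_{n\to\infty}\sqrt{\lambda_n}\,\gamma(\mu\circ T_n^{-1},\nu)=0,\qquad \lim_{n\to\infty}M_{\lambda_n}(T_n)=M(T^* ),$$ where $T^*$ is the unique optimal transport map from $\mu$ to $\nu$ for the cost $c$. In particular, $\{T_n\}_{n=1}^\infty$ converges to $T^*$ in law under $\mu$, i.e. $\mu\circ T_n^{-1}$ converges weakly to $\mu\circ (T^* )^{-1}$.
   Context: For a Borel map $T:\mathbb{R}^d\to\mathbb{R}^d$, $\mu\circ T^{-1}$ denotes the pushforward of $\mu$ by $T$, i.e. $(\mu\circ T^{-1})(A)=\mu(\{x: T(x)\in A\})$ for Borel sets $A$. $|\cdot|$ is the Euclidean norm. Optimal transport map (Monge problem): $T^*$ is a minimizer of $M(T)$ over all Borel measurable $T:\mathbb{R}^d\to\mathbb{R}^d$ with $\mu\circ T^{-1}=\nu$. Under the stated hypotheses on $\mu,\nu$ and with quadratic cost, such a $T^*$ is known to exist and to be unique (up to $\mu$-almost everywhere equality). Strictly positive definite kernel: a function $K:\mathbb{R}^d\times\mathbb{R}^d\to\mathbb{R}$ that is symmetric ($K(x,y)=K(y,x)$) and satisfies $\sum_{j,\ell=1}^N\alpha_j\alpha_\ell K(x_j,x_\ell)>0$ for every positive integer $N$, all distinct $x_1,\dots,x_N\in\mathbb{R}^d$ and all $(\alpha_1,\dots,\alpha_N)\in\mathbb{R}^N\setminus\{0\}$. Maximum mean discrepancy: let $\mathcal{H}$ be the unique Hilbert space of functions on $\mathbb{R}^d$ with norm $\|\cdot\|$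 for which $K$ is the reproducing kernel. For $\mu_0,\mu_1\in\mathcal{P}(\mathbb{R}^d)$, $$\gamma_K(\mu_0,\mu_1)=\sup_{f\in\mathcal{H},\,\|f\|\le1}\left|\int_{\mathbb{R}^d} f\,d\mu_0-\int_{\mathbb{R}^d} f\,d\mu_1\right| .$$ "$\gamma$ metrizes the weak topology on $\mathcal{P}(\mathbb{R}^d)$" means that $\gamma$ is a metric on $\mathcal{P}(\mathbb{R}^d)$ whose topology is the topology of weak convergence of probability measures (convergence of integrals of bounded continuous functions). *)

theory Defs
  imports "HOL-Probability.Probability"
begin

section \<open>Borel probability measures and the weak topology\<close>

definition borel_prob :: "'a::topological_space measure set" where
  "borel_prob = {m. prob_space m \<and> sets m = sets borel}"

definition weak_topology :: "'a::topological_space measure topology" where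
  "weak_topology = topology_generated_by
     {{m \<in> borel_prob. (\<integral>x. f x \<partial>m) \<in> U} | (f :: 'a \<Rightarrow> real) U.
        continuous_on UNIV f \<and> bounded (range f) \<and> open U}"

definition converges_weakly ::
    "(nat \<Rightarrow> 'a::topological_space measure) \<Rightarrow> 'a measure \<Rightarrow> bool" where
  "converges_weakly m m0 \<longleftrightarrow>
     (\<forall>f :: 'a \<Rightarrow> real. continuous_on UNIV f \<and> bounded (range f) \<longrightarrow>
        (\<lambda>n. \<integral>x. f x \<partial>m n) \<longlonglongrightarrow> (\<integral>x. f x \<partial>m0))"

lemma topspace_weak_topology [simp]: "topspace weak_topology = borel_prob"
proof -
  have "borel_prob \<in> {{m \<in> borel_prob. (\<integral>x. f x \<partial>m) \<in> U} | (f :: 'a::topological_space \<Rightarrow> real) U.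
        continuous_on UNIV f \<and> bounded (range f) \<and> open U}"
    by (rule CollectI, rule exI[of _ "\<lambda>_. 0"], rule exI[of _ UNIV]) simp
  then show ?thesis
    unfolding weak_topology_def topology_generated_by_topspace by auto
qed

lemma limitin_weak_topology:
  assumes "\<And>n. m n \<in> borel_prob" "m0 \<in> borel_prob"
  shows "limitin weak_topology m m0 sequentially \<longleftrightarrow> converges_weakly m m0"
proof
  assume lim: "limitin weak_topology m m0 sequentially"
  show "converges_weakly m m0"
    unfolding converges_weakly_def
  proof (intro allI impI topological_tendstoI)
    fix f :: "'a \<Rightarrow> real" and S :: "real set"
    assume f: "continuous_on UNIV f \<and> bounded (range f)" and S: "open S" "(\<integral>x. f x \<partial>m0) \<in> S"
    have "openin weak_topology {m \<in> borel_prob. (\<integral>x. f x \<partial>m) \<in> S}"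
      unfolding weak_topology_def by (rule topology_generated_by_Basis) (use f S in blast)
    then have "\<forall>\<^sub>F n in sequentially. m n \<in> {m \<in> borel_prob. (\<integral>x. f x \<partial>m) \<in> S}"
      using lim S assms(2) unfolding limitin_def by blast
    then show "\<forall>\<^sub>F n in sequentially. (\<integral>x. f x \<partial>m n) \<in> S"
      by (rule eventually_mono) auto
  qed
next
  assume conv: "converges_weakly m m0"
  have *: "generate_topology_on {{m \<in> borel_prob. (\<integral>x. f x \<partial>m) \<in> U} | (f :: 'a \<Rightarrow> real) U.
        continuous_on UNIV f \<and> bounded (range f) \<and> open U} V \<Longrightarrow>
      m0 \<in> V \<Longrightarrow> (\<forall>\<^sub>F n in sequentially. m n \<in> V)" for V
  proof (induction rule: generate_topology_on.induct)
    case Empty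
    then show ?case by simp
  next
    case (Int a b)
    have "\<forall>\<^sub>F n in sequentially. m n \<in> a" "\<forall>\<^sub>F n in sequentially. m n \<in> b"
      using Int.IH Int.prems by simp_all
    then show ?case by (rule eventually_elim2) simp
  next
    case (UN K)
    from UN.prems obtain k where k: "k \<in> K" "m0 \<in> k" by (rule UnionE)
    have "\<forall>\<^sub>F n in sequentially. m n \<in> k" by (rule UN.IH[OF k])
    then show ?case by (rule eventually_mono) (rule UnionI[OF k(1)])
  next
    case (Basis s)
    then obtain f :: "'a \<Rightarrow> real" and U where s: "s = {m \<in> borel_prob. (\<integral>x. f x \<partial>m) \<in> U}"
      and f: "continuous_on UNIV f \<and> bounded (range f)" "open U" by auto
    have lim: "(\<lambda>n. \<integral>x. f x \<partial>m n) \<longlonglongrightarrow> (\<integral>x. f x \<partial>m0)"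
      using conv f(1) unfolding converges_weakly_def by simp
    have "(\<integral>x. f x \<partial>m0) \<in> U" using Basis.prems s by simp
    from topological_tendstoD[OF lim f(2) this] show ?case
      by (rule eventually_mono) (simp add: s assms(1))
  qed
  show "limitin weak_topology m m0 sequentially"
    unfolding limitin_def
  proof (intro conjI allI impI)
    show "m0 \<in> topspace weak_topology"
      using assms(2) by simp
    fix V assume V: "openin weak_topology V \<and> m0 \<in> V"
    show "\<forall>\<^sub>F n in sequentially. m n \<in> V"
    proof (rule *)
      show "m0 \<in> V" using V by (rule conjunct2)
    qed (rule iffD1[OF openin_topology_generated_by_iff, OF V[THEN conjunct1, unfolded weak_topology_def]])
  qed
qed

definition metrizes_weak_topology ::
    "('a::topological_space measure \<Rightarrow> 'a measure \<Rightarrow> real) \<Rightarrow> bool" where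
  "metrizes_weak_topology \<gamma> \<longleftrightarrow>
     Metric_space borel_prob \<gamma> \<and> Metric_space.mtopology borel_prob \<gamma> = weak_topology"


section \<open>Reproducing kernel Hilbert spaces and the maximum mean discrepancy\<close>

definition strictly_positive_definite :: "('a \<Rightarrow> 'a \<Rightarrow> real) \<Rightarrow> bool" where
  "strictly_positive_definite K \<longleftrightarrow>
     (\<forall>x y. K x y = K y x) \<and>
     (\<forall>N\<ge>1. \<forall>(x :: nat \<Rightarrow> 'a) (\<alpha> :: nat \<Rightarrow> real).
        inj_on x {1..N} \<and> (\<exists>j\<in>{1..N}. \<alpha> j \<noteq> 0) \<longrightarrow>
        (\<Sum>j=1..N. \<Sum>l=1..N. \<alpha> j * \<alpha> l * K (x j) (x l)) > 0)"

text \<open>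
  A real Hilbert space of functions is a set \<open>H\<close> of functions together with an inner product
  \<open>ip\<close> on it. Since HOL functions are total, \<open>ip\<close> is required to vanish off \<open>H\<close>;
  this makes the pair \<open>(H, ip)\<close> with a given reproducing kernel unique.
\<close>

locale hilbert_function_space =
  fixes H :: "('a \<Rightarrow> real) set" and ip :: "('a \<Rightarrow> real) \<Rightarrow> ('a \<Rightarrow> real) \<Rightarrow> real"
  assumes zero_mem: "(\<lambda>x. 0) \<in> H"
    and add_mem: "f \<in> H \<Longrightarrow> g \<in> H \<Longrightarrow> (\<lambda>x. f x + g x) \<in> H"
    and scale_mem: "f \<in> H \<Longrightarrow> (\<lambda>x. c * f x) \<in> H"
    and ip_commute: "f \<in> H \<Longrightarrow> g \<in> H \<Longrightarrow> ip f g = ip g f"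
    and ip_add: "f \<in> H \<Longrightarrow> g \<in> H \<Longrightarrow> h \<in> H \<Longrightarrow> ip (\<lambda>x. f x + g x) h = ip f h + ip g h"
    and ip_scale: "f \<in> H \<Longrightarrow> g \<in> H \<Longrightarrow> ip (\<lambda>x. c * f x) g = c * ip f g"
    and ip_nonneg: "f \<in> H \<Longrightarrow> ip f f \<ge> 0"
    and ip_eq_0: "f \<in> H \<Longrightarrow> ip f f = 0 \<Longrightarrow> f = (\<lambda>x. 0)"
    and ip_off: "f \<notin> H \<or> g \<notin> H \<Longrightarrow> ip f g = 0"
    and complete: "\<lbrakk>\<And>n :: nat. s n \<in> H;
        \<And>e. e > 0 \<Longrightarrow> \<exists>N. \<forall>m\<ge>N. \<forall>n\<ge>N.
           sqrt (ip (\<lambda>x. s m x - s n x) (\<lambda>x. s m x - s n x)) < e\<rbrakk>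
      \<Longrightarrow> \<exists>f\<in>H. (\<lambda>n. sqrt (ip (\<lambda>x. s n x - f x) (\<lambda>x. s n x - f x))) \<longlonglongrightarrow> 0"

locale reproducing_kernel_hilbert_space = hilbert_function_space H ip
  for K :: "'a \<Rightarrow> 'a \<Rightarrow> real"
    and H :: "('a \<Rightarrow> real) set" and ip :: "('a \<Rightarrow> real) \<Rightarrow> ('a \<Rightarrow> real) \<Rightarrow> real" +
  assumes kernel_mem: "(\<lambda>x. K x y) \<in> H"
    and reproducing: "f \<in> H \<Longrightarrow> f y = ip f (\<lambda>x. K x y)"

definition rkhs ::
    "('a \<Rightarrow> 'a \<Rightarrow> real) \<Rightarrow> ('a \<Rightarrow> real) set \<times> (('a \<Rightarrow> real) \<Rightarrow> ('a \<Rightarrow> real) \<Rightarrow> real)" where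
  "rkhs K = (THE (H, ip). reproducing_kernel_hilbert_space K H ip)"

definition rkhs_unit_ball :: "('a \<Rightarrow> 'a \<Rightarrow> real) \<Rightarrow> ('a \<Rightarrow> real) set" where
  "rkhs_unit_ball K = {f \<in> fst (rkhs K). sqrt (snd (rkhs K) f f) \<le> 1}"

text \<open>
  The value \<open>0\<close> off \<open>borel_prob\<close> is a convention: \<open>Metric_space\<close> asks for
  nonnegativity and symmetry of the distance on the whole type. On \<open>borel_prob\<close> the set
  under the supremum is bounded whenever \<open>K\<close> is.
\<close>

definition mmd ::
    "('a::topological_space \<Rightarrow> 'a \<Rightarrow> real) \<Rightarrow> 'a measure \<Rightarrow> 'a measure \<Rightarrow> real" where
  "mmd K m0 m1 =
     (if m0 \<in> borel_prob \<and> m1 \<in> borel_prob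
      then (SUP f\<in>rkhs_unit_ball K. \<bar>(\<integral>x. f x \<partial>m0) - (\<integral>x. f x \<partial>m1)\<bar>)
      else 0)"


section \<open>Monge's problem and its penalized version\<close>

definition monge_cost :: "'a::euclidean_space measure \<Rightarrow> ('a \<Rightarrow> 'a) \<Rightarrow> ennreal" where
  "monge_cost \<mu> T = (\<integral>\<^sup>+x. ennreal ((norm (x - T x))\<^sup>2) \<partial>\<mu>)"

definition optimal_transport_map ::
    "'a::euclidean_space measure \<Rightarrow> 'a measure \<Rightarrow> ('a \<Rightarrow> 'a) \<Rightarrow> bool" where
  "optimal_transport_map \<mu> \<nu> T \<longleftrightarrow>
     T \<in> borel_measurable borel \<and> distr \<mu> borel T = \<nu> \<and>
     (\<forall>S \<in> borel_measurable borel. distr \<mu> borel S = \<nu> \<longrightarrow> monge_cost \<mu> T \<le> monge_cost \<mu> S)"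

definition penalized_cost ::
    "('a::euclidean_space \<Rightarrow> 'a \<Rightarrow> real) \<Rightarrow> 'a measure \<Rightarrow> 'a measure \<Rightarrow> real \<Rightarrow> ('a \<Rightarrow> 'a) \<Rightarrow> ennreal"
  where
  "penalized_cost K \<mu> \<nu> l T =
     monge_cost \<mu> T + ennreal (l * (mmd K (distr \<mu> borel T) \<nu>)\<^sup>2)"

definition penalized_inf ::
    "('a::euclidean_space \<Rightarrow> 'a \<Rightarrow> real) \<Rightarrow> 'a measure \<Rightarrow> 'a measure \<Rightarrow> real \<Rightarrow> ennreal" where
  "penalized_inf K \<mu> \<nu> l = (INF T\<in>borel_measurable borel. penalized_cost K \<mu> \<nu> l T)"

end

theory Submission
  imports Defs
begin

text \<open>
  Everything follows from two facts about \<open>P n = monge_cost \<mu> (T n)\<close> and the penalty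
  \<open>G n = lam n * (mmd K (distr \<mu> borel (T n)) \<nu>)\<^sup>2\<close>.

  \<^item> Upper bound. The map \<open>Tstar\<close> is a competitor without penalty, hence
    \<open>P n + G n \<le> monge_cost \<mu> Tstar + \<epsilon> n\<close>. The right-hand side is bounded and \<open>lam n\<close> tends to
    infinity, so the discrepancy tends to \<open>0\<close>. As it metrizes the weak topology, the laws of
    \<open>T n\<close> converge weakly to \<open>\<nu>\<close>.

  \<^item> Lower bound. Weak convergence of the laws implies
    \<open>monge_cost \<mu> Tstar \<le> liminf P\<close> (\<open>optimal_cost_le_liminf\<close>).

  Together they squeeze both \<open>P n\<close> and \<open>P n + G n\<close> to \<open>monge_cost \<mu> Tstar\<close>, and so \<open>G n\<close>, the
  square of the quantity in the first limit, tends to \<open>0\<close>.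

  The lower bound is the substance. The maps \<open>T n\<close> do not transport \<mu> to \<nu>, but they can be
  repaired: once the law of \<open>T n\<close> is weakly close to \<nu>, some exact transport map \<open>S\<close> is within
  \<open>d\<close> of \<open>T n\<close> outside a set of \<mu>-measure at most \<open>d\<close>
  (\<open>exact_transport_in_probability\<close>). To see this, cover \<nu>-almost everything by disjoint open
  cells \<open>Q k\<close> of diameter below \<open>d\<close>. Weak convergence gives each of finitely many preimages
  \<open>T n -` Q k\<close> almost the mass \<open>\<nu> (Q k)\<close>; a part of it of exactly that mass, up to a factor
  \<open>1 - e\<close>, is transported onto \<open>\<nu>\<close> restricted to \<open>Q k\<close>, which moves no point far from its image
  under \<open>T n\<close>. The few remaining points absorb the remaining mass of \<nu> in any way. Their cost is
  small because \<mu> and \<nu> have finite second moments, and \<open>Tstar\<close> costs at most as much as \<open>S\<close>.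

  Both the choice of subsets of prescribed mass and the transport onto prescribed measures
  (\<open>transport_finite\<close>) rest on \<mu> vanishing on the hyperplanes orthogonal to one basis vector.
  They reduce to the real line: one coordinate of \<mu> has a continuous distribution function, which
  makes it uniform; a quantile function turns the uniform law into any law on the line; and a Borel
  embedding of the space into the line (\<open>borel_embedding_real\<close>) carries that over to any target.
\<close>

section \<open>A Borel embedding into the real line\<close>

text \<open>
  With digits \<open>0\<close> and \<open>1\<close> only, the tail of a ternary expansion is at most \<open>1/2\<close>, so the digits
  can be read off from the value by a floor, without ambiguity.
\<close>

lemma ternary_digit:
  fixes b :: "nat \<Rightarrow> bool"
  shows "\<lfloor>3 ^ Suc n * (\<Sum>m. of_bool (b m) / 3 ^ Suc m :: real)\<rfloor> mod 3 = of_bool (b n)"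
proof -
  define t where "t m = (of_bool (b m) / 3 ^ Suc m :: real)" for m
  define r where "r = (\<Sum>m. of_bool (b (m + Suc n)) / 3 ^ Suc m :: real)"
  define z :: int where "z = (\<Sum>m<n. of_bool (b m) * 3 ^ (n - Suc m))"
  have geo: "(\<lambda>m. 1 / 3 ^ Suc m :: real) sums (1/2)"
    using sums_mult[OF geometric_sums[of "1/3 :: real"], of "1/3"] by (simp add: power_divide)
  have sm: "summable (\<lambda>m. of_bool (c m) / 3 ^ Suc m :: real)" for c
    by (rule summable_comparison_test[OF _ sums_summable[OF geo]]) (auto simp: divide_simps)
  have "suminf t = (\<Sum>m. t (m + Suc n)) + sum t {..<Suc n}"
    unfolding t_def by (rule suminf_split_initial_segment[OF sm])
  moreover have "3 ^ Suc n * (\<Sum>m. t (m + Suc n)) = r"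
    unfolding r_def t_def
    by (subst suminf_mult[symmetric])
       (use summable_ignore_initial_segment[OF sm, of b "Suc n"] in \<open>auto intro!: suminf_cong simp: power_add\<close>)
  moreover have "3 ^ Suc n * sum t {..<n} = 3 * of_int z"
  proof -
    have "3 ^ Suc n * t m = 3 * of_int (of_bool (b m) * 3 ^ (n - Suc m))" if "m < n" for m
    proof -
      have "(3::real) ^ n = 3 ^ Suc m * 3 ^ (n - Suc m)"
        using that by (subst power_add[symmetric]) simp
      then show ?thesis by (simp add: t_def)
    qed
    then show ?thesis
      unfolding z_def of_int_sum sum_distrib_left by (intro sum.cong) auto
  qed
  moreover have "3 ^ Suc n * t n = of_bool (b n)"
    by (simp add: t_def)
  ultimately have eq: "3 ^ Suc n * suminf t = of_int (3 * z + of_bool (b n)) + r"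
    by (simp only: sum.lessThan_Suc distrib_left) simp
  have "0 \<le> r"
    unfolding r_def by (rule suminf_nonneg[OF sm]) simp
  moreover have "r \<le> 1/2"
    unfolding r_def sums_unique[OF geo]
    by (rule suminf_le[OF _ sm sums_summable[OF geo]]) (simp add: divide_simps)
  ultimately have "\<lfloor>3 ^ Suc n * suminf t\<rfloor> = 3 * z + of_bool (b n)"
    unfolding eq by (intro floor_unique) auto
  then show ?thesis by (simp add: t_def[abs_def])
qed

text \<open>
  The digits of \<open>h x\<close> record which balls of radius \<open>(1/2) ^ k\<close> around a dense sequence contain
  \<open>x\<close>. Conversely, for each \<open>k\<close> the digits yield a centre within \<open>(1/2) ^ k\<close> of \<open>x\<close>, and these
  centres converge to \<open>x\<close>. This description of the left inverse \<open>g\<close> shows that it is Borel.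
\<close>

lemma borel_embedding_real:
  obtains h :: "'a::{banach, second_countable_topology} \<Rightarrow> real" and g :: "real \<Rightarrow> 'a"
  where "h \<in> borel_measurable borel" "g \<in> borel_measurable borel" "\<And>x. g (h x) = x"
proof -
  obtain D :: "'a set" where D: "countable D" "\<And>X. open X \<Longrightarrow> X \<noteq> {} \<Longrightarrow> \<exists>d\<in>D. d \<in> X"
    using countable_dense_setE by metis
  then have "D \<noteq> {}" by force
  define c where "c = from_nat_into D"
  have dense: "\<exists>j. dist (c j) x < e" if e: "e > 0" for x e
  proof -
    obtain d where "d \<in> D" "d \<in> ball x e" using D(2)[of "ball x e"] e by auto
    moreover then obtain j where "c j = d"
      using from_nat_into_surj[OF D(1)] unfolding c_def by metis
    ultimately show ?thesis by (auto simp: dist_commute)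
  qed
  define b where "b n x = (case prod_decode n of (j, k) \<Rightarrow> dist (c j) x < (1/2) ^ k)" for n x
  define h where "h x = (\<Sum>n. of_bool (b n x) / 3 ^ Suc n :: real)" for x
  define digit where "digit n y = \<lfloor>3 ^ Suc n * y\<rfloor> mod 3" for n and y :: real
  define g where "g y = lim (\<lambda>k. c (LEAST j. digit (prod_encode (j, k)) y = 1))" for y
  have [measurable]: "Measurable.pred borel (b n)" for n
    unfolding b_def[abs_def] by (cases "prod_decode n") simp
  have "h \<in> borel_measurable borel"
    unfolding h_def[abs_def] by measurable
  moreover have [measurable]: "Measurable.pred borel (\<lambda>y. digit n y = 1)" for n
  proof -
    have "digit n \<in> measurable borel (count_space UNIV)"
      unfolding digit_def[abs_def] by measurable
    then show ?thesis by measurable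
  qed
  have "g \<in> borel_measurable borel"
    unfolding g_def[abs_def] by measurable
  moreover have "g (h x) = x" for x
  proof -
    define j where "j k = (LEAST j. dist (c j) x < (1/2) ^ k)" for k
    have "dist (c (j k)) x < (1/2) ^ k" for k
      unfolding j_def by (rule LeastI_ex) (simp add: dense)
    then have "(\<lambda>k. c (j k)) \<longlonglongrightarrow> x"
      unfolding tendsto_dist_iff[of _ x]
      by (intro real_tendsto_sandwich[OF _ _ tendsto_const LIMSEQ_power_zero[of "1/2::real"]]
          always_eventually allI) (auto intro: less_imp_le)
    moreover have "g (h x) = lim (\<lambda>k. c (j k))"
      unfolding g_def j_def digit_def h_def ternary_digit by (simp add: b_def)
    ultimately show ?thesis by (simp add: limI)
  qed
  ultimately show thesis by (rule that)
qed

section \<open>Transporting a measure without mass on parallel hyperplanes\<close>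

text \<open>
  The probability integral transform: apart from the extreme levels, sublevel sets of a continuous
  distribution function are half-lines \<open>{..s}\<close> at whose endpoint the level is attained.
\<close>

lemma (in finite_borel_measure) measure_cdf_le:
  assumes na: "\<And>x. measure M {x} = 0" and u: "0 \<le> u" "u \<le> measure M (space M)"
  shows "measure M {x. cdf M x \<le> u} = u"
proof -
  let ?L = "{x. cdf M x \<le> u}"
  have cont: "isCont (cdf M) x" for x
    using isCont_cdf na by simp
  have cl: "closed ?L"
    by (intro closed_Collect_le continuous_at_imp_continuous_on ballI cont continuous_const)
  consider "u = measure M (space M)" | "u < measure M (space M)" "?L = {}" | "u < measure M (space M)" "?L \<noteq> {}"
    using u by fastforce
  then show ?thesis
  proof cases
    case 1
    then have "?L = UNIV" using cdf_bounded by auto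
    then show ?thesis using 1 by (simp add: borel_UNIV)
  next
    case 2
    have "u \<le> 0"
      by (rule tendsto_lowerbound[OF cdf_lim_at_bot]) (use 2 in \<open>auto intro!: always_eventually less_imp_le simp: not_le\<close>)
    then show ?thesis using u 2(2) by simp
  next
    case 3
    obtain y where y: "u < cdf M y"
      using order_tendstoD(1)[OF cdf_lim_at_top 3(1)]
      by (auto dest!: eventually_happens'[OF trivial_limit_at_top_linorder])
    have bdd: "bdd_above ?L"
    proof (rule bdd_aboveI[of _ y])
      fix x assume "x \<in> ?L"
      then show "x \<le> y" using y cdf_nondecreasing[of y x] by (cases "x \<le> y") auto
    qed
    define s where "s = Sup ?L"
    have s: "s \<in> ?L" unfolding s_def by (rule closed_contains_Sup[OF 3(2) bdd cl])
    have above: "u < cdf M x" if "s < x" for x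
    proof (rule ccontr)
      assume "\<not> u < cdf M x"
      then have "x \<le> s" unfolding s_def by (intro cSup_upper bdd) simp
      with that show False by simp
    qed
    have "(cdf M \<longlongrightarrow> cdf M s) (at_right s)"
      using cont[of s] unfolding isCont_def by (rule filterlim_mono) (simp_all add: at_le)
    then have "u \<le> cdf M s"
      by (rule tendsto_lowerbound)
         (auto intro!: eventually_at_rightI[of s "s + 1"] less_imp_le above)
    with s have "cdf M s = u" by simp
    moreover have "?L = {..s}"
      using s above cdf_nondecreasing by (force simp: not_less[symmetric])
    ultimately show ?thesis by (simp add: cdf_def)
  qed
qed

text \<open>
  The monotone map: the distribution function of \<open>D\<close> followed by the quantile function of \<open>E\<close>.
\<close>

lemma transport_real:
  assumes "real_distribution D" "real_distribution E" and na: "\<And>x. measure D {x} = 0"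
  obtains S where "S \<in> borel_measurable borel" "distr D borel S = E"
proof -
  interpret D: cdf_distribution D using assms(1) by (simp add: cdf_distribution_def)
  interpret E: cdf_distribution E using assms(2) by (simp add: cdf_distribution_def)
  \<comment> \<open>the quantile function \<open>E.I\<close> is meaningful on the open unit interval only, and \<open>D.C\<close> lies there almost surely\<close>
  define S where "S x = (if D.C x \<in> {0<..<1} then E.I (D.C x) else 0)" for x
  have "(\<lambda>u. if u \<in> {0<..<1} then E.I u else 0) \<in> borel_measurable borel"
    using E.measurable_CI by (subst (asm) measurable_restrict_space_iff[of _ _ 0]) auto
  from measurable_compose[OF D.measurable_C this]
  have S [measurable]: "S \<in> borel_measurable borel" by (simp add: S_def[abs_def])
  have law: "measure D {x. D.C x \<le> u} = u" if "0 \<le> u" "u \<le> 1" for u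
    using D.measure_cdf_le[OF na] that D.prob_space by simp
  have "AE x in D. D.C x \<in> {0<..<1}"
  proof -
    have "measure D {x. D.C x \<le> 0} = 0" by (rule law) auto
    then have 1: "AE x in D. \<not> D.C x \<le> 0"
      by (subst (asm) D.prob_eq_0) auto
    have "1 \<le> measure D {x. D.C x < 1}"
    proof (rule dense_le_bounded[of 0])
      fix u :: real assume u: "0 < u" "u < 1"
      have "u = measure D {x. D.C x \<le> u}" using law[of u] u by simp
      also have "\<dots> \<le> measure D {x. D.C x < 1}"
        using u by (intro D.finite_measure_mono) auto
      finally show "u \<le> measure D {x. D.C x < 1}" .
    qed simp
    then have "measure D {x. D.C x < 1} = 1" using D.prob_le_1 by (intro antisym)
    then have "AE x in D. x \<in> {x. D.C x < 1}"
      by (subst (asm) D.prob_eq_1) auto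
    with 1 show ?thesis by eventually_elim auto
  qed
  then have SI: "AE x in D. (S x \<le> y) \<longleftrightarrow> (D.C x \<le> E.C y)" for y
  proof eventually_elim
    case (elim x)
    then show ?case using E.pseudoinverse[of "D.C x" y] unfolding S_def by auto
  qed
  have "distr D borel S = E"
  proof (rule cdf_unique)
    show "real_distribution (distr D borel S)" by simp
    show "cdf (distr D borel S) = E.C"
    proof
      fix y
      have "cdf (distr D borel S) y = measure D {x. S x \<le> y}"
        by (simp add: cdf_def measure_distr vimage_def)
      also have "\<dots> = measure D {x. D.C x \<le> E.C y}"
        using SI[of y] by (intro D.finite_measure_eq_AE) auto
      also have "\<dots> = E.C y" by (rule law) (auto simp: E.cdf_nonneg E.cdf_bounded_prob)
      finally show "cdf (distr D borel S) y = E.C y" .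
    qed
  qed fact
  with S show thesis by (rule that)
qed

text \<open>
  This is the weak form of absolute continuity that makes the law of the coordinate \<open>x \<bullet> b\<close>
  atomless.
\<close>

definition null_slices :: "'a::euclidean_space measure \<Rightarrow> 'a \<Rightarrow> bool" where
  "null_slices M b \<longleftrightarrow> (\<forall>c. emeasure M {x. x \<bullet> b = c} = 0)"

lemma null_slices_absolutely_continuous:
  assumes "absolutely_continuous lborel M" "b \<in> Basis"
  shows "null_slices M b"
  unfolding null_slices_def
proof
  fix c
  have "negligible {x. x \<bullet> b = c}"
    by (rule negligible_standard_hyperplane[OF assms(2)])
  then have "{x. x \<bullet> b = c} \<in> null_sets lborel"
    by (simp add: negligible_iff_null_sets null_sets_completion_iff)
  then show "emeasure M {x. x \<bullet> b = c} = 0"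
    using assms(1) by (auto simp: absolutely_continuous_def)
qed

text \<open>
  A Borel embedding with its left inverse makes \<open>N\<close> a law on the real line, and the coordinate
  \<open>x \<bullet> b\<close> can be transported onto that law.
\<close>

lemma transport_prob:
  fixes P N :: "'a::euclidean_space measure"
  assumes P: "prob_space P" "sets P = sets borel" "null_slices P b"
    and N: "prob_space N" "sets N = sets borel"
  obtains S where "S \<in> borel_measurable borel" "distr P borel S = N"
proof -
  interpret P: prob_space P by fact
  interpret N: prob_space N by fact
  note [measurable_cong] = P(2) N(2)
  have [simp]: "space P = UNIV" using sets_eq_imp_space_eq[OF P(2)] by simp
  obtain h :: "'a \<Rightarrow> real" and g where hg [measurable]: "h \<in> borel_measurable borel" "g \<in> borel_measurable borel"
    and inv: "\<And>x. g (h x) = x"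
    using borel_embedding_real by blast
  let ?D = "distr P borel (\<lambda>x. x \<bullet> b)" and ?E = "distr N borel h"
  have "measure ?D {c} = 0" for c
    using P(3) by (simp add: measure_def emeasure_distr vimage_def null_slices_def)
  then obtain S where [measurable]: "S \<in> borel_measurable borel" and S: "distr ?D borel S = ?E"
    by (rule transport_real[rotated 2]) auto
  have "distr P borel (\<lambda>x. g (S (x \<bullet> b))) = distr (distr ?D borel S) borel g"
    by (simp add: distr_distr comp_def)
  also have "\<dots> = distr N borel (\<lambda>x. g (h x))"
    unfolding S by (simp add: distr_distr comp_def)
  also have "\<dots> = N"
    unfolding inv by (rule distr_id2) (simp add: N(2))
  finally show thesis
    by (intro that[of "\<lambda>x. g (S (x \<bullet> b))"]) measurable
qed

lemma transport_finite:
  fixes M N :: "'a::euclidean_space measure"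
  assumes M: "sets M = sets borel" "null_slices M b"
    and N: "sets N = sets borel"
    and mass: "emeasure M UNIV = emeasure N UNIV" and fin: "emeasure N UNIV \<noteq> \<infinity>"
  obtains S where "S \<in> borel_measurable borel" "\<And>B. B \<in> sets borel \<Longrightarrow> emeasure M (S -` B) = emeasure N B"
proof (cases "emeasure N UNIV = 0")
  case True
  have "emeasure N B = 0" "emeasure M B = 0" for B
    using emeasure_mono[of B UNIV M] emeasure_mono[of B UNIV N] True mass M(1) N by auto
  then show thesis by (intro that[of "\<lambda>_. 0"]) auto
next
  case False
  define c where "c = 1 / emeasure N UNIV"
  have c: "c * emeasure N UNIV = 1" "c \<noteq> 0" "c \<noteq> \<infinity>"
  proof -
    have "emeasure N UNIV < top" using fin by (simp add: top.not_eq_extremum[symmetric])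
    then show "c * emeasure N UNIV = 1" "c \<noteq> 0" "c \<noteq> \<infinity>"
      using False unfolding c_def
      by (auto simp: ennreal_divide_times ennreal_divide_eq_top_iff)
  qed
  have sp: "space M = UNIV" "space N = UNIV"
    using sets_eq_imp_space_eq[OF M(1)] sets_eq_imp_space_eq[OF N] by auto
  have prob: "prob_space (scale_measure c M)" "prob_space (scale_measure c N)"
    using c(1) mass by (auto intro!: prob_spaceI simp: sp space_scale_measure)
  have "null_slices (scale_measure c M) b"
    using M(2) by (simp add: null_slices_def)
  then obtain S where S: "S \<in> borel_measurable borel" "distr (scale_measure c M) borel S = scale_measure c N"
    using transport_prob[OF prob(1) _ _ prob(2)] M(1) N by (metis sets_scale_measure)
  have "emeasure M (S -` B) = emeasure N B" if "B \<in> sets borel" for B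
  proof -
    have "c * emeasure M (S -` B) = emeasure (distr (scale_measure c M) borel S) B"
      using S(1) that M(1) by (subst emeasure_distr) (auto simp: space_scale_measure sp cong: measurable_cong_sets)
    also have "\<dots> = c * emeasure N B"
      unfolding S(2) by simp
    finally show ?thesis
      using c by (simp add: ennreal_mult_cancel_left)
  qed
  with S(1) show thesis by (rule that)
qed

lemma emeasure_restrict_density:
  assumes "sets M = sets borel" "A \<in> sets borel" "B \<in> sets borel"
  shows "emeasure (density M (indicator A)) B = emeasure M (A \<inter> B)"
  using assms by (subst emeasure_density) (auto simp: indicator_inter_arith[symmetric])

lemma null_slices_restrict:
  assumes "sets M = sets borel" "null_slices M b" "A \<in> sets borel"
  shows "null_slices (density M (indicator A)) b"
  unfolding null_slices_def
proof
  fix c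
  have "{x. x \<bullet> b = c} \<in> sets borel" by measurable
  then have "emeasure (density M (indicator A)) {x. x \<bullet> b = c} = emeasure M (A \<inter> {x. x \<bullet> b = c})"
    by (rule emeasure_restrict_density[OF assms(1,3)])
  also have "\<dots> \<le> emeasure M {x. x \<bullet> b = c}"
    using assms(1) by (intro emeasure_mono) auto
  finally show "emeasure (density M (indicator A)) {x. x \<bullet> b = c} = 0"
    using assms(2) by (simp add: null_slices_def)
qed

text \<open>
  The points of \<open>A\<close> whose coordinate lies in a sublevel set of the distribution function of that
  coordinate on \<open>A\<close>.
\<close>

lemma exists_subset_of_measure:
  fixes M :: "'a::euclidean_space measure"
  assumes M: "finite_measure M" "sets M = sets borel" "null_slices M b"
    and A: "A \<in> sets borel" and u: "0 \<le> u" "u \<le> measure M A"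
  obtains A' where "A' \<in> sets borel" "A' \<subseteq> A" "measure M A' = u"
proof -
  let ?M = "density M (indicator A)"
  let ?D = "distr ?M borel (\<lambda>x. x \<bullet> b)"
  note [measurable_cong] = M(2)
  note [measurable] = A
  have sp: "space M = UNIV" using sets_eq_imp_space_eq[OF M(2)] by simp
  have eD: "emeasure ?D B = emeasure M (A \<inter> {x. x \<bullet> b \<in> B})" if [measurable]: "B \<in> sets borel" for B
  proof -
    have "emeasure ?D B = emeasure ?M {x. x \<bullet> b \<in> B}"
      by (simp add: emeasure_distr vimage_def sp)
    also have "\<dots> = emeasure M (A \<inter> {x. x \<bullet> b \<in> B})"
      by (rule emeasure_restrict_density[OF M(2) A]) measurable
    finally show ?thesis .
  qed
  then have D: "measure ?D B = measure M (A \<inter> {x. x \<bullet> b \<in> B})" if "B \<in> sets borel" for B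
    using that by (simp add: measure_def)
  have "finite_measure ?D"
    using finite_measure.emeasure_finite[OF M(1)]
    by (intro finite_measureI) (simp add: eD)
  then interpret finite_borel_measure ?D
    by (rule finite_borel_measure.intro[OF _ finite_borel_measure_axioms.intro]) simp
  have "measure ?D {c} = 0" for c
  proof -
    have "emeasure M (A \<inter> {x. x \<bullet> b \<in> {c}}) \<le> emeasure M {x. x \<bullet> b = c}"
      by (intro emeasure_mono) auto
    then show ?thesis using M(3) by (simp add: measure_def eD null_slices_def)
  qed
  moreover have "u \<le> measure ?D (space ?D)"
    using u by (simp add: D)
  ultimately have "measure ?D {c. cdf ?D c \<le> u} = u"
    using u by (intro measure_cdf_le)
  moreover have [measurable]: "cdf ?D \<in> borel_measurable borel"
    by (intro borel_measurable_mono monoI cdf_nondecreasing)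
  ultimately show thesis
    by (intro that[of "A \<inter> {x. x \<bullet> b \<in> {c. cdf ?D c \<le> u}}"]) (auto simp: D)
qed

text \<open>
  The index of the piece that contains a point is a measurable function of the point, so maps
  chosen separately on the pieces glue to one Borel map.
\<close>

lemma piecewise_transport:
  fixes M :: "'a::euclidean_space measure" and N :: "nat \<Rightarrow> 'a measure" and A :: "nat \<Rightarrow> 'a set"
  assumes M: "sets M = sets borel" "null_slices M b"
    and A: "\<And>k. A k \<in> sets borel" "disjoint_family A" "(\<Union>k. A k) = UNIV"
    and N: "\<And>k. sets (N k) = sets borel" "\<And>k. emeasure (N k) UNIV \<noteq> \<infinity>"
    and mass: "\<And>k. emeasure M (A k) = emeasure (N k) UNIV"
  obtains S where "S \<in> borel_measurable borel"
    "\<And>k B. B \<in> sets borel \<Longrightarrow> emeasure M (A k \<inter> S -` B) = emeasure (N k) B"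
proof -
  have "\<exists>S. S \<in> borel_measurable borel \<and> (\<forall>B\<in>sets borel. emeasure M (A k \<inter> S -` B) = emeasure (N k) B)" for k
  proof -
    let ?M = "density M (indicator (A k))"
    have "emeasure ?M UNIV = emeasure (N k) UNIV"
      using emeasure_restrict_density[OF M(1) A(1)[of k], of UNIV] mass[of k] by simp
    then obtain S where S: "S \<in> borel_measurable borel" "\<And>B. B \<in> sets borel \<Longrightarrow> emeasure ?M (S -` B) = emeasure (N k) B"
      using transport_finite[OF _ null_slices_restrict[OF M A(1)[of k]] N(1) _ N(2)] M(1)
      by (metis sets_density)
    moreover have "S -` B \<in> sets borel" if "B \<in> sets borel" for B
      using measurable_sets[OF S(1) that] by simp
    ultimately show ?thesis
      using emeasure_restrict_density[OF M(1) A(1)[of k]] by (intro exI[of _ S]) auto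
  qed
  then obtain S where S: "\<And>k. S k \<in> borel_measurable borel"
    "\<And>k B. B \<in> sets borel \<Longrightarrow> emeasure M (A k \<inter> S k -` B) = emeasure (N k) B"
    by metis
  define j where "j x = (LEAST k. x \<in> A k)" for x
  have j: "j x = k" if "x \<in> A k" for x k
  proof -
    have "x \<in> A (j x)" unfolding j_def by (rule LeastI[of _ k]) fact
    then show ?thesis using that A(2) by (auto simp: disjoint_family_on_def)
  qed
  have [measurable]: "j \<in> measurable borel (count_space UNIV)"
    unfolding j_def[abs_def] using A(1) by measurable
  show thesis
  proof (rule that[of "\<lambda>x. S (j x) x"])
    show "(\<lambda>x. S (j x) x) \<in> borel_measurable borel"
      by (rule measurable_compose_countable[OF S(1)]) measurable
    show "emeasure M (A k \<inter> (\<lambda>x. S (j x) x) -` B) = emeasure (N k) B" if "B \<in> sets borel" for k B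
    proof -
      have "A k \<inter> (\<lambda>x. S (j x) x) -` B = A k \<inter> S k -` B" using j by auto
      then show ?thesis using S(2)[OF that] by simp
    qed
  qed
qed

section \<open>Repairing approximate transport maps\<close>

text \<open>
  The part of the portmanteau theorem on open sets: the indicator of \<open>U\<close> is an increasing limit
  of bounded continuous functions.
\<close>

lemma converges_weakly_open:
  fixes m :: "nat \<Rightarrow> 'a::metric_space measure"
  assumes conv: "converges_weakly m m0" and m: "\<And>n. m n \<in> borel_prob" "m0 \<in> borel_prob"
    and U: "open U" and c: "c < measure m0 U"
  shows "\<forall>\<^sub>F n in sequentially. c < measure (m n) U"
  \<comment> \<open>\<open>infdist x (- U)\<close> is \<open>0\<close> rather than infinite when the complement is empty\<close>
proof (cases "U = UNIV")
  case True
  have "measure M UNIV = 1" if "M \<in> borel_prob" for M :: "'a measure"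
    using prob_space.prob_space[of M] sets_eq_imp_space_eq[of M borel] that by (auto simp: borel_prob_def)
  then show ?thesis using c m True by simp
next
  case False
  define f where "f k x = min 1 (real k * infdist x (- U))" for k x
  have cont: "continuous_on UNIV (f k)" for k
    unfolding f_def by (intro continuous_intros)
  have f01: "0 \<le> f k x" "f k x \<le> 1" for k x
    by (auto simp: f_def infdist_nonneg)
  have fle: "f k x \<le> indicator U x" for k x
    using f01(2)[of k x] by (cases "x \<in> U") (auto simp: f_def)
  have bdd: "bounded (range (f k))" for k
    using f01 by (intro boundedI[of _ 1]) auto
  have int: "integrable M (f k)" "integrable M (indicator U :: 'a \<Rightarrow> real)"
    "(\<integral>x. indicator U x \<partial>M) = measure M U" if "M \<in> borel_prob" for k and M :: "'a measure"
  proof -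
    interpret prob_space M using that by (simp add: borel_prob_def)
    have [measurable_cong]: "sets M = sets borel" using that by (simp add: borel_prob_def)
    have [measurable]: "U \<in> sets borel" "f k \<in> borel_measurable borel"
      using U cont by (auto intro: borel_measurable_continuous_onI)
    show "integrable M (f k)"
      using f01 by (intro integrable_const_bound[of _ 1]) auto
    show "integrable M (indicator U :: 'a \<Rightarrow> real)" "(\<integral>x. indicator U x \<partial>M) = measure M U"
      by (auto simp: integrable_indicator_iff emeasure_eq_measure)
  qed
  have "(\<lambda>k. \<integral>x. f k x \<partial>m0) \<longlonglongrightarrow> (\<integral>x. indicator U x \<partial>m0)"
  proof (rule integral_dominated_convergence[where w = "\<lambda>_. 1"])
    interpret prob_space m0 using m by (simp add: borel_prob_def)
    show "integrable m0 (\<lambda>_. 1::real)" by simp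
    show "AE x in m0. (\<lambda>k. f k x) \<longlonglongrightarrow> indicator U x"
    proof (rule AE_I2)
      fix x
      show "(\<lambda>k. f k x) \<longlonglongrightarrow> indicator U x"
      proof (cases "x \<in> U")
        case True
        then have d: "0 < infdist x (- U)"
          using U False by (intro infdist_pos_not_in_closed) auto
        obtain k0 where k0: "1 / infdist x (- U) < real k0" using reals_Archimedean2 by blast
        have "\<forall>\<^sub>F k in sequentially. f k x = 1"
          using eventually_ge_at_top[of k0]
        proof eventually_elim
          case (elim k)
          then have "1 / infdist x (- U) < real k" using k0 by (smt (verit) of_nat_le_iff)
          then show ?case using d by (simp add: f_def divide_simps split: if_splits)
        qed
        then show ?thesis using True by (simp add: tendsto_eventually)
      qed (simp add: f_def)
    qed
    show "AE x in m0. norm (f k x) \<le> 1" for k using f01 by simp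
    show "f k \<in> borel_measurable m0" for k using int(1)[OF m(2)] by auto
    show "(indicator U :: 'a \<Rightarrow> real) \<in> borel_measurable m0" using int(2)[OF m(2)] by (rule borel_measurable_integrable)
  qed
  then have "(\<lambda>k. \<integral>x. f k x \<partial>m0) \<longlonglongrightarrow> measure m0 U" using int(3)[OF m(2)] by simp
  from order_tendstoD(1)[OF this c] obtain k where k: "c < (\<integral>x. f k x \<partial>m0)"
    by (auto dest!: eventually_happens)
  have "(\<lambda>n. \<integral>x. f k x \<partial>m n) \<longlonglongrightarrow> (\<integral>x. f k x \<partial>m0)"
    using conv cont bdd by (auto simp: converges_weakly_def)
  from order_tendstoD(1)[OF this k] show ?thesis
  proof eventually_elim
    case (elim n)
    also have "(\<integral>x. f k x \<partial>m n) \<le> (\<integral>x. indicator U x \<partial>m n)"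
      by (intro integral_mono int m fle)
    also have "\<dots> = measure (m n) U" by (rule int(3)[OF m(1)])
    finally show ?case .
  qed
qed

text \<open>
  Balls of one common radius \<open>r\<close> around a dense sequence cover the space. Only countably many radii
  give positive mass to some sphere, so \<open>r\<close> can be chosen such that all spheres are null sets;
  then removing the earlier closed balls instead of the earlier open ones loses only a null set
  and leaves open cells.
\<close>

lemma small_open_cells:
  fixes N :: "'a::{metric_space, second_countable_topology} measure"
  assumes N: "N \<in> borel_prob" and d: "d > 0"
  obtains Q :: "nat \<Rightarrow> 'a set" where "\<And>k. open (Q k)" "disjoint_family Q"
    "\<And>k x y. x \<in> Q k \<Longrightarrow> y \<in> Q k \<Longrightarrow> dist x y < d" "AE x in N. x \<in> (\<Union>k. Q k)"
proof -
  interpret prob_space N using N by (simp add: borel_prob_def)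
  have sN [measurable_cong]: "sets N = sets borel" using N by (simp add: borel_prob_def)
  have sp: "space N = UNIV" using sets_eq_imp_space_eq[OF sN] by simp
  obtain D :: "'a set" where D: "countable D" "\<And>X. open X \<Longrightarrow> X \<noteq> {} \<Longrightarrow> \<exists>d\<in>D. d \<in> X"
    using countable_dense_setE by metis
  then have "D \<noteq> {}" by force
  define c where "c = from_nat_into D"
  define Z where "Z k = {r. measure (distr N borel (dist (c k))) {r} \<noteq> 0}" for k
  have "countable (Z k)" for k
    unfolding Z_def
    by (rule finite_measure.countable_support, rule prob_space.finite_measure, rule prob_space_distr) measurable
  then have "countable (\<Union>k. Z k)" by auto
  then obtain r where r: "r \<in> {0<..<d / 2}" "r \<notin> (\<Union>k. Z k)"
    using open_minus_countable[of "\<Union>k. Z k" "{0<..<d / 2}"] d by auto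
  have "AE x in N. dist (c k) x \<noteq> r" for k
  proof -
    have "measure N {x. dist (c k) x = r} = 0"
      using r(2) by (auto simp: Z_def measure_distr vimage_def sp)
    then have "AE x in N. x \<notin> {x. dist (c k) x = r}"
      by (subst (asm) prob_eq_0) auto
    then show ?thesis by simp
  qed
  then have AE: "AE x in N. \<forall>k. dist (c k) x \<noteq> r" by (simp add: AE_all_countable)
  define Q where "Q k = ball (c k) r - (\<Union>j<k. cball (c j) r)" for k
  show thesis
  proof (rule that[of Q])
    show "open (Q k)" for k unfolding Q_def by (intro open_Diff closed_UN) auto
    have "Q i \<inter> Q j = {}" if "i < j" for i j
      using that by (auto simp: Q_def intro: less_imp_le)
    then show "disjoint_family Q"
      unfolding disjoint_family_on_def by (metis linorder_neqE_nat Int_commute)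
    show "dist x y < d" if "x \<in> Q k" "y \<in> Q k" for k x y
      using that r(1) dist_triangle_less_add[of x "c k" r y r] by (auto simp: Q_def dist_commute)
    show "AE x in N. x \<in> (\<Union>k. Q k)"
      using AE
    proof eventually_elim
      case (elim x)
      obtain e where "e \<in> D" "e \<in> ball x r" using D(2)[of "ball x r"] r(1) by auto
      moreover then obtain i where "c i = e"
        using from_nat_into_surj[OF D(1)] unfolding c_def by metis
      ultimately have ex: "\<exists>i. dist (c i) x < r" by (auto simp: dist_commute)
      define k where "k = (LEAST i. dist (c i) x < r)"
      have "dist (c k) x < r" unfolding k_def by (rule LeastI_ex[OF ex])
      moreover have "\<not> dist (c j) x \<le> r" if "j < k" for j
        using not_less_Least[OF that[unfolded k_def]] elim by (auto simp: less_le)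
      ultimately have "x \<in> Q k" by (auto simp: Q_def)
      then show ?case by blast
    qed
  qed
qed

text \<open>
  For \<open>k < m\<close>, a subset \<open>A' k\<close> of \<open>T -` Q k\<close> with mass \<open>a * measure N (Q k)\<close> is transported onto \<open>a\<close> times the
  restriction of \<open>N\<close> to \<open>Q k\<close>, so that \<open>S x\<close> and \<open>T x\<close> lie in the same cell for almost all \<open>x\<close> in
  \<open>A' k\<close>. What is left of \<open>M\<close> is transported onto what is left of \<open>N\<close>.
\<close>

lemma transport_along_cells:
  fixes M N :: "'a::euclidean_space measure" and Q :: "nat \<Rightarrow> 'a set"
  assumes M: "M \<in> borel_prob" "null_slices M b" and N: "N \<in> borel_prob"
    and T: "T \<in> borel_measurable borel"
    and Q: "\<And>k. Q k \<in> sets borel" "disjoint_family Q"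
    and diam: "\<And>k x y. x \<in> Q k \<Longrightarrow> y \<in> Q k \<Longrightarrow> dist x y < d"
    and a: "0 \<le> a" "a \<le> 1" and le: "\<And>k. k < m \<Longrightarrow> a * measure N (Q k) \<le> measure M (T -` Q k)"
  obtains S where "S \<in> borel_measurable borel" "distr M borel S = N"
    "measure M {x. \<not> dist (S x) (T x) < d} \<le> 1 - a * (\<Sum>k<m. measure N (Q k))"
proof -
  interpret M: prob_space M using M(1) by (simp add: borel_prob_def)
  interpret N: prob_space N using N by (simp add: borel_prob_def)
  have sM [measurable_cong]: "sets M = sets borel" and sN [measurable_cong]: "sets N = sets borel"
    using M(1) N by (auto simp: borel_prob_def)
  have sp: "space M = UNIV" "space N = UNIV"
    using sets_eq_imp_space_eq[OF sM] sets_eq_imp_space_eq[OF sN] by auto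
  note [measurable] = T Q(1)
  have TQ: "T -` Q k \<in> sets borel" for k
    using measurable_sets[OF T Q(1)] by simp
  have "\<exists>A'. A' \<in> sets borel \<and> A' \<subseteq> T -` Q k \<and> measure M A' = (if k < m then a * measure N (Q k) else 0)" for k
  proof (cases "k < m")
    case True
    then show ?thesis
      using exists_subset_of_measure[OF M.finite_measure_axioms sM M(2) TQ[of k], of "a * measure N (Q k)"]
        le a(1) by (metis measure_nonneg mult_nonneg_nonneg)
  qed (auto intro!: exI[of _ "{}"])
  then obtain A' where A' [measurable]: "\<And>k. A' k \<in> sets borel" and A'T: "\<And>k. A' k \<subseteq> T -` Q k"
    and mA': "\<And>k. measure M (A' k) = (if k < m then a * measure N (Q k) else 0)"
    by metis
  have "A' i \<inter> A' j = {}" if "i \<noteq> j" for i j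
    using A'T[of i] A'T[of j] Q(2) that by (fastforce simp: disjoint_family_on_def)
  then have disj': "disjoint_family A'" by (simp add: disjoint_family_on_def)
  \<comment> \<open>piece \<open>0\<close> of the partition is the remainder, piece \<open>Suc k\<close> belongs to the cell \<open>Q k\<close>\<close>
  define A where "A = case_nat (- (\<Union>k. A' k)) A'"
  have A [measurable]: "A k \<in> sets borel" for k
    unfolding A_def by (cases k) auto
  have disj: "disjoint_family A"
    using disj' unfolding disjoint_family_on_def A_def by (auto split: nat.splits)
  have cover: "(\<Union>k. A k) = UNIV"
  proof -
    have "x \<in> (\<Union>k. A k)" for x
    proof (cases "\<exists>k. x \<in> A' k")
      case True
      then obtain k where "x \<in> A (Suc k)" by (auto simp: A_def)
      then show ?thesis by blast
    next
      case False
      then have "x \<in> A 0" by (simp add: A_def)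
      then show ?thesis by blast
    qed
    then show ?thesis by auto
  qed
  \<comment> \<open>a partition of unity: the densities with respect to \<open>N\<close> of the targets of the pieces\<close>
  define p where "p = case_nat (\<lambda>y. 1 - (\<Sum>k<m. a * indicat_real (Q k) y))
    (\<lambda>k y. if k < m then a * indicat_real (Q k) y else 0)"
  have [measurable]: "p k \<in> borel_measurable borel" for k
    unfolding p_def by (cases k) auto
  have p0: "0 \<le> p k y" for k y
  proof (cases k)
    case 0
    have "(\<Sum>k<m. indicat_real (Q k) y) = indicator (\<Union>k<m. Q k) y"
      using Q(2) by (intro indicator_UN_disjoint[symmetric]) (auto simp: disjoint_family_on_def)
    also have "\<dots> \<le> 1" by (simp add: indicator_def)
    finally have "a * (\<Sum>k<m. indicat_real (Q k) y) \<le> 1"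
      using a by (meson mult_le_one sum_nonneg indicator_pos_le)
    then show ?thesis using 0 by (simp add: p_def sum_distrib_left)
  qed (auto simp: p_def a)
  have p1: "(\<Sum>k. ennreal (p k y)) = 1" for y
  proof -
    have "(\<Sum>k. ennreal (p k y)) = (\<Sum>k<Suc m. ennreal (p k y))"
      by (rule suminf_finite) (auto simp: p_def split: nat.splits)
    also have "\<dots> = ennreal (\<Sum>k<Suc m. p k y)"
      by (rule sum_ennreal) (rule p0)
    also have "(\<Sum>k<Suc m. p k y) = 1"
      by (subst sum.lessThan_Suc_shift) (simp add: p_def)
    finally show ?thesis by simp
  qed
  define N' where "N' k = density N (\<lambda>y. ennreal (p k y))" for k
  have N'B: "emeasure (N' k) B = (\<integral>\<^sup>+y. ennreal (p k y) * indicator B y \<partial>N)" if "B \<in> sets borel" for k B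
    unfolding N'_def using that by (subst emeasure_density) auto
  have sumN': "(\<Sum>k. emeasure (N' k) B) = emeasure N B" if [measurable]: "B \<in> sets borel" for B
  proof -
    have "(\<Sum>k. emeasure (N' k) B) = (\<integral>\<^sup>+y. (\<Sum>k. ennreal (p k y) * indicator B y) \<partial>N)"
      unfolding N'B[OF that] by (rule nn_integral_suminf[symmetric]) measurable
    also have "\<dots> = (\<integral>\<^sup>+y. indicator B y \<partial>N)"
      by (simp add: p1)
    also have "\<dots> = emeasure N B" by simp
    finally show ?thesis .
  qed
  have mR: "measure M (A 0) = 1 - (\<Sum>k<m. a * measure N (Q k))"
  proof -
    have "(\<lambda>k. measure M (A' k)) sums measure M (\<Union>k. A' k)"
      using disj' by (intro M.finite_measure_UNION) auto
    moreover have "(\<lambda>k. measure M (A' k)) sums (\<Sum>k<m. measure M (A' k))"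
      by (intro sums_finite) (auto simp: mA')
    ultimately have "measure M (\<Union>k. A' k) = (\<Sum>k<m. measure M (A' k))" by (rule sums_unique2)
    moreover have "measure M (A 0) = 1 - measure M (\<Union>k. A' k)"
      unfolding A_def using M.prob_compl[of "\<Union>k. A' k"] by (simp add: sp Compl_eq_Diff_UNIV)
    ultimately show ?thesis by (simp add: mA')
  qed
  have int: "integrable N (p k)" "(\<integral>y. p k y \<partial>N) = measure M (A k)" for k
  proof -
    have iQ: "integrable N (indicat_real (Q k))" for k
      by (auto simp: integrable_indicator_iff N.emeasure_eq_measure)
    have i\<Sigma>: "integrable N (\<lambda>y. \<Sum>k<m. a * indicat_real (Q k) y)"
      by (intro Bochner_Integration.integrable_sum integrable_mult_right iQ)
    have e\<Sigma>: "(\<integral>y. (\<Sum>k<m. a * indicat_real (Q k) y) \<partial>N) = (\<Sum>k<m. a * measure N (Q k))"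
      by (subst Bochner_Integration.integral_sum) (use iQ in auto)
    show "integrable N (p k)"
    proof (cases k)
      case 0
      then show ?thesis using Bochner_Integration.integrable_diff[OF _ i\<Sigma>, of "\<lambda>_. 1"] by (simp only: p_def) simp
    next
      case (Suc j)
      then show ?thesis using iQ[of j] by (cases "j < m") (auto simp: p_def)
    qed
    show "(\<integral>y. p k y \<partial>N) = measure M (A k)"
    proof (cases k)
      case 0
      have "(\<integral>y. 1 - (\<Sum>k<m. a * indicat_real (Q k) y) \<partial>N) = 1 - (\<Sum>k<m. a * measure N (Q k))"
        by (subst Bochner_Integration.integral_diff[OF _ i\<Sigma>]) (use N.prob_space e\<Sigma> in simp_all)
      then show ?thesis using 0 mR by (simp only: p_def) simp
    next
      case (Suc j)
      then show ?thesis using mA'[of j] by (cases "j < m") (simp_all add: p_def A_def)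
    qed
  qed
  have mass: "emeasure M (A k) = emeasure (N' k) UNIV" for k
    using int p0 by (subst N'B) (auto simp: nn_integral_eq_integral M.emeasure_eq_measure)
  have sN': "sets (N' k) = sets borel" for k by (simp add: N'_def sN)
  have finN': "emeasure (N' k) UNIV \<noteq> \<infinity>" for k
    unfolding mass[symmetric] by (simp add: M.emeasure_eq_measure)
  obtain S where S [measurable]: "S \<in> borel_measurable borel"
    and SB: "\<And>k B. B \<in> sets borel \<Longrightarrow> emeasure M (A k \<inter> S -` B) = emeasure (N' k) B"
    by (rule piecewise_transport[OF sM M(2) A disj cover sN' finN' mass]) blast
  have SBm: "S -` B \<in> sets borel" if "B \<in> sets borel" for B
    using measurable_sets[OF S that] by simp
  have "distr M borel S = N"
  proof (rule measure_eqI)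
    show "sets (distr M borel S) = sets N" by (simp add: sN)
    fix B assume "B \<in> sets (distr M borel S)"
    then have B: "B \<in> sets borel" by simp
    have "(\<Union>k. A k \<inter> S -` B) = S -` B" using cover by blast
    then have "emeasure (distr M borel S) B = emeasure M (\<Union>k. A k \<inter> S -` B)"
      using B by (subst emeasure_distr) (auto simp: sp)
    also have "\<dots> = (\<Sum>k. emeasure M (A k \<inter> S -` B))"
      using disj SBm[OF B] by (intro suminf_emeasure[symmetric]) (auto simp: sM disjoint_family_on_def)
    also have "\<dots> = emeasure N B"
      by (simp add: SB B sumN')
    finally show "emeasure (distr M borel S) B = emeasure N B" .
  qed
  moreover have "measure M {x. \<not> dist (S x) (T x) < d} \<le> 1 - a * (\<Sum>k<m. measure N (Q k))"
  proof -
    have "AE x in M. x \<notin> A (Suc k) \<inter> S -` (- Q k)" for k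
    proof (rule AE_not_in, rule null_setsI)
      have "emeasure (N' (Suc k)) (- Q k) = 0"
        by (subst N'B) (auto simp: p_def nn_integral_0_iff_AE indicator_def)
      then show "emeasure M (A (Suc k) \<inter> S -` (- Q k)) = 0"
        by (subst SB) auto
      show "A (Suc k) \<inter> S -` (- Q k) \<in> sets M"
        using SBm[of "- Q k"] A[of "Suc k"] by (auto simp: sM)
    qed
    then have "AE x in M. \<forall>k. x \<notin> A (Suc k) \<inter> S -` (- Q k)" by (simp add: AE_all_countable)
    then have "AE x in M. \<not> dist (S x) (T x) < d \<longrightarrow> x \<in> A 0"
    proof eventually_elim
      case (elim x)
      have "dist (S x) (T x) < d" if out: "x \<notin> A 0"
      proof -
        obtain k where k: "x \<in> A' k" using out by (auto simp: A_def)
        then have "x \<in> A (Suc k)" by (simp add: A_def)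
        then have "S x \<in> Q k" using elim by blast
        then show ?thesis using A'T k by (intro diam) auto
      qed
      then show ?case by blast
    qed
    then have "measure M {x. \<not> dist (S x) (T x) < d} \<le> measure M (A 0)"
      by (intro M.finite_measure_mono_AE) (auto simp: sM)
    also have "\<dots> = 1 - a * (\<Sum>k<m. measure N (Q k))"
      by (simp add: mR sum_distrib_left)
    finally show ?thesis .
  qed
  ultimately show thesis using S by (intro that)
qed

text \<open>
  Finitely many cells carry mass more than \<open>1 - e\<close>, and for large \<open>n\<close> the map \<open>T n\<close> fills each of
  them up to a factor \<open>1 - e\<close>. So all but a mass of \<open>1 - (1 - e)\<^sup>2 \<le> 2 * e\<close> is transported
  within the cells.
\<close>

proposition exact_transport_in_probability:
  fixes M N :: "'a::euclidean_space measure"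
  assumes M: "M \<in> borel_prob" "null_slices M b" and N: "N \<in> borel_prob"
    and T: "\<And>n. T n \<in> borel_measurable borel"
    and conv: "converges_weakly (\<lambda>n. distr M borel (T n)) N"
    and d: "d > 0"
  shows "\<forall>\<^sub>F n in sequentially. \<exists>S\<in>borel_measurable borel. distr M borel S = N \<and>
    measure M {x. \<not> dist (S x) (T n x) < d} \<le> d"
proof -
  interpret N: prob_space N using N by (simp add: borel_prob_def)
  have sM: "sets M = sets borel" and sN: "sets N = sets borel"
    using M(1) N by (auto simp: borel_prob_def)
  have sp: "space M = UNIV" "space N = UNIV"
    using sets_eq_imp_space_eq[OF sM] sets_eq_imp_space_eq[OF sN] by auto
  have law: "distr M borel (T n) \<in> borel_prob" for n
    using M(1) T[of n] by (auto simp: borel_prob_def intro!: prob_space.prob_space_distr cong: measurable_cong_sets)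
  define e where "e = min d 1 / 2"
  have e: "0 < e" "e < 1" "2 * e \<le> d" using d by (auto simp: e_def)
  obtain Q :: "nat \<Rightarrow> 'a set" where Q: "\<And>k. open (Q k)" "disjoint_family Q"
    and diam: "\<And>k x y. x \<in> Q k \<Longrightarrow> y \<in> Q k \<Longrightarrow> dist x y < d" and full: "AE x in N. x \<in> (\<Union>k. Q k)"
    using small_open_cells[OF N d] by metis
  have "(\<lambda>k. measure N (Q k)) sums measure N (\<Union>k. Q k)"
    using Q by (intro N.finite_measure_UNION) (auto simp: sN)
  moreover have "measure N (\<Union>k. Q k) = 1"
    using full Q(1) by (subst N.prob_eq_1) (auto simp: sN)
  ultimately have "(\<lambda>m. \<Sum>k<m. measure N (Q k)) \<longlonglongrightarrow> 1" by (simp add: sums_def)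
  then have "\<forall>\<^sub>F m in sequentially. 1 - e < (\<Sum>k<m. measure N (Q k))"
    by (rule order_tendstoD(1)) (use e(1) in simp)
  then obtain m where m: "1 - e < (\<Sum>k<m. measure N (Q k))"
    using eventually_happens'[OF sequentially_bot] by blast
  have "\<forall>\<^sub>F n in sequentially. (1 - e) * measure N (Q k) \<le> measure (distr M borel (T n)) (Q k)" for k
  proof (cases "measure N (Q k) = 0")
    case False
    then have "(1 - e) * measure N (Q k) < measure N (Q k)"
      using e(1) by (simp add: measure_nonneg less_le algebra_simps)
    from converges_weakly_open[OF conv law N Q(1) this] show ?thesis
      by (rule eventually_mono) simp
  qed simp
  then have "\<forall>\<^sub>F n in sequentially. \<forall>k\<in>{..<m}. (1 - e) * measure N (Q k) \<le> measure (distr M borel (T n)) (Q k)"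
    by (intro eventually_ball_finite) auto
  then show ?thesis
  proof eventually_elim
    case (elim n)
    have le: "(1 - e) * measure N (Q k) \<le> measure M (T n -` Q k)" if "k < m" for k
    proof -
      have "T n \<in> borel_measurable M" using T[of n] sM by (simp cong: measurable_cong_sets)
      then have "measure (distr M borel (T n)) (Q k) = measure M (T n -` Q k)"
        using Q(1)[of k] by (simp add: measure_distr sp)
      then show ?thesis using elim that by (metis lessThan_iff)
    qed
    have Qb: "Q k \<in> sets borel" for k using Q(1) by simp
    obtain S where S: "S \<in> borel_measurable borel" "distr M borel S = N"
      "measure M {x. \<not> dist (S x) (T n x) < d} \<le> 1 - (1 - e) * (\<Sum>k<m. measure N (Q k))"
      by (rule transport_along_cells[OF M N T Qb Q(2) diam _ _ le]) (use e in auto)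
    have "(1 - e) * (1 - e) \<le> (1 - e) * (\<Sum>k<m. measure N (Q k))"
      using m e by (intro mult_left_mono) auto
    moreover have "1 - (1 - e) * (1 - e) \<le> 2 * e" by (simp add: algebra_simps)
    ultimately have "1 - (1 - e) * (\<Sum>k<m. measure N (Q k)) \<le> d" using e(3) by linarith
    with S show ?case by (intro bexI[of _ S]) auto
  qed
qed

section \<open>Lower semicontinuity of the optimal cost\<close>

text \<open>
  All compositions \<open>f \<circ> S\<close> with \<open>S\<close> of law \<open>N\<close> have one and the same law, so they are
  uniformly integrable: beyond a level \<open>k\<close> they carry little, uniformly in \<open>S\<close>, and below
  that level they contribute at most \<open>k * measure M R\<close>.
\<close>

lemma uniformly_integrable_composition:
  fixes N :: "'a::topological_space measure" and f :: "'a \<Rightarrow> real"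
  assumes N: "sets N = sets borel" and f [measurable]: "f \<in> borel_measurable borel" and f0: "\<And>y. 0 \<le> f y"
    and fin: "(\<integral>\<^sup>+y. ennreal (f y) \<partial>N) < \<infinity>" and e: "e > 0"
  obtains d where "d > 0"
    "\<And>(M :: 'b measure) S R. \<lbrakk>finite_measure M; S \<in> borel_measurable M;
        distr M borel S = N; R \<in> sets M; measure M R \<le> d\<rbrakk>
      \<Longrightarrow> (\<integral>\<^sup>+x. ennreal (f (S x)) * indicator R x \<partial>M) \<le> ennreal e"
proof -
  note [measurable_cong] = N
  define h where "h k y = ennreal (f y) * indicator {y. real k < f y} y" for k y
  have [measurable]: "h k \<in> borel_measurable borel" for k
    unfolding h_def[abs_def] by measurable
  have "(\<lambda>k. \<integral>\<^sup>+y. h k y \<partial>N) \<longlonglongrightarrow> (\<integral>\<^sup>+y. 0 \<partial>N)"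
  proof (rule nn_integral_dominated_convergence[where w = "\<lambda>y. ennreal (f y)"])
    show "AE y in N. (\<lambda>k. h k y) \<longlonglongrightarrow> 0"
    proof (rule AE_I2)
      fix y
      obtain k0 where k0: "f y \<le> real k0" using real_arch_simple by blast
      have "\<forall>\<^sub>F k in sequentially. h k y = 0"
        using eventually_ge_at_top[of k0]
      proof eventually_elim
        case (elim k)
        then have "real k0 \<le> real k" by simp
        then show ?case using k0 by (simp add: h_def)
      qed
      then show "(\<lambda>k. h k y) \<longlonglongrightarrow> 0" by (rule tendsto_eventually)
    qed
  qed (use fin in \<open>auto simp: h_def indicator_def\<close>)
  then have "(\<lambda>k. \<integral>\<^sup>+y. h k y \<partial>N) \<longlonglongrightarrow> 0" by simp
  then have "\<forall>\<^sub>F k in sequentially. (\<integral>\<^sup>+y. h k y \<partial>N) < ennreal (e / 2)"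
    by (rule order_tendstoD(2)) (use e in simp)
  then obtain k where k: "(\<integral>\<^sup>+y. h k y \<partial>N) < ennreal (e / 2)"
    using eventually_happens'[OF sequentially_bot] by blast
  show thesis
  proof (rule that[of "e / (2 * (real k + 1))"])
    show "0 < e / (2 * (real k + 1))" using e by simp
    fix M :: "'b measure" and S R
    assume M: "finite_measure M" and S [measurable]: "S \<in> borel_measurable M"
      and SN: "distr M borel S = N" and R [measurable]: "R \<in> sets M"
      and small: "measure M R \<le> e / (2 * (real k + 1))"
    interpret finite_measure M by fact
    have "(\<integral>\<^sup>+x. ennreal (f (S x)) * indicator R x \<partial>M)
        \<le> (\<integral>\<^sup>+x. ennreal (real k) * indicator R x + h k (S x) \<partial>M)"
    proof (rule nn_integral_mono)
      fix x
      show "ennreal (f (S x)) * indicator R x \<le> ennreal (real k) * indicator R x + h k (S x)"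
        using f0[of "S x"] by (cases "real k < f (S x)") (auto simp: h_def indicator_def intro: ennreal_leI)
    qed
    also have "\<dots> = ennreal (real k) * emeasure M R + (\<integral>\<^sup>+y. h k y \<partial>N)"
      unfolding SN[symmetric] by (subst nn_integral_add) (auto simp: nn_integral_cmult nn_integral_distr)
    also have "\<dots> \<le> ennreal (e / 2) + ennreal (e / 2)"
    proof (rule add_mono)
      have "real k * measure M R \<le> real k * (e / (2 * (real k + 1)))"
        using small by (rule mult_left_mono) simp
      also have "\<dots> \<le> e / 2" using e by (simp add: field_simps)
      finally show "ennreal (real k) * emeasure M R \<le> ennreal (e / 2)"
        by (simp add: emeasure_eq_measure ennreal_mult[symmetric] ennreal_leI)
    qed (use k in simp)
    also have "\<dots> = ennreal e" using e by (simp add: ennreal_plus[symmetric] del: ennreal_plus)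
    finally show "(\<integral>\<^sup>+x. ennreal (f (S x)) * indicator R x \<partial>M) \<le> ennreal e" .
  qed
qed

lemma norm_diff_square_le: "(norm (x - y))\<^sup>2 \<le> 2 * (norm x)\<^sup>2 + 2 * (norm (y::'a::real_normed_vector))\<^sup>2"
proof -
  have "(norm (x - y))\<^sup>2 \<le> (norm x + norm y)\<^sup>2"
    by (intro power_mono norm_triangle_ineq4) simp
  also have "\<dots> \<le> 2 * (norm x)\<^sup>2 + 2 * (norm y)\<^sup>2"
    using zero_le_power2[of "norm x - norm y"] by (simp add: power2_eq_square algebra_simps)
  finally show ?thesis .
qed

lemma monge_cost_finite:
  assumes M: "sets M = sets borel" and T: "T \<in> borel_measurable borel"
    and fin: "(\<integral>\<^sup>+x. ennreal ((norm x)\<^sup>2) \<partial>M) < \<infinity>" "(\<integral>\<^sup>+y. ennreal ((norm y)\<^sup>2) \<partial>distr M borel T) < \<infinity>"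
  shows "monge_cost M T < \<infinity>"
proof -
  note [measurable] = T and [measurable_cong] = M
  have "monge_cost M T \<le> (\<integral>\<^sup>+x. 2 * ennreal ((norm x)\<^sup>2) + 2 * ennreal ((norm (T x))\<^sup>2) \<partial>M)"
    unfolding monge_cost_def
  proof (rule nn_integral_mono)
    fix x
    have "2 * ennreal ((norm x)\<^sup>2) + 2 * ennreal ((norm (T x))\<^sup>2) = ennreal (2 * (norm x)\<^sup>2 + 2 * (norm (T x))\<^sup>2)"
      by (simp add: ennreal_mult)
    then show "ennreal ((norm (x - T x))\<^sup>2) \<le> 2 * ennreal ((norm x)\<^sup>2) + 2 * ennreal ((norm (T x))\<^sup>2)"
      using norm_diff_square_le[of x "T x"] by (simp only: ennreal_leI)
  qed
  also have "\<dots> = 2 * (\<integral>\<^sup>+x. ennreal ((norm x)\<^sup>2) \<partial>M) + 2 * (\<integral>\<^sup>+y. ennreal ((norm y)\<^sup>2) \<partial>distr M borel T)"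
    by (subst nn_integral_add) (auto simp: nn_integral_cmult nn_integral_distr)
  also have "\<dots> < \<infinity>"
    using fin by (simp add: ennreal_mult_less_top)
  finally show ?thesis .
qed

text \<open>
  The optimal map is compared with an exact transport map \<open>S\<close> close to \<open>T n\<close>. Where \<open>S\<close> and
  \<open>T n\<close> are close, the two costs are comparable; on the small remaining set the cost of \<open>S\<close> is
  controlled by the second moments of \<open>M\<close> and \<open>N\<close>, the latter being the law of \<open>S\<close>.
\<close>

lemma optimal_cost_le_perturbed_cost:
  fixes M N :: "'a::euclidean_space measure"
  assumes M: "M \<in> borel_prob" "null_slices M b" and N: "N \<in> borel_prob"
    and fin: "(\<integral>\<^sup>+x. ennreal ((norm x)\<^sup>2) \<partial>M) < \<infinity>" "(\<integral>\<^sup>+y. ennreal ((norm y)\<^sup>2) \<partial>N) < \<infinity>"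
    and T: "\<And>n. T n \<in> borel_measurable borel"
    and conv: "converges_weakly (\<lambda>n. distr M borel (T n)) N"
    and opt: "optimal_transport_map M N T'"
    and e: "0 < e" "e \<le> 1"
  shows "\<forall>\<^sub>F n in sequentially. monge_cost M T' \<le> ennreal (1 + e) * monge_cost M (T n) + ennreal (6 * e)"
proof -
  interpret prob_space M using M by (simp add: borel_prob_def)
  have sM [measurable_cong]: "sets M = sets borel" and sN [measurable_cong]: "sets N = sets borel"
    using M(1) N by (auto simp: borel_prob_def)
  have sp: "space M = UNIV" using sets_eq_imp_space_eq[OF sM] by simp
  have sq: "(\<lambda>x::'a. (norm x)\<^sup>2) \<in> borel_measurable borel" by measurable
  obtain d1 where "d1 > 0" and d1: "\<And>(M' :: 'a measure) S R. \<lbrakk>finite_measure M'; S \<in> borel_measurable M';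
        distr M' borel S = M; R \<in> sets M'; measure M' R \<le> d1\<rbrakk>
      \<Longrightarrow> (\<integral>\<^sup>+x. ennreal ((norm (S x))\<^sup>2) * indicator R x \<partial>M') \<le> ennreal e"
    by (rule uniformly_integrable_composition[OF sM sq _ fin(1) e(1)]) auto
  obtain d2 where "d2 > 0" and d2: "\<And>(M' :: 'a measure) S R. \<lbrakk>finite_measure M'; S \<in> borel_measurable M';
        distr M' borel S = N; R \<in> sets M'; measure M' R \<le> d2\<rbrakk>
      \<Longrightarrow> (\<integral>\<^sup>+x. ennreal ((norm (S x))\<^sup>2) * indicator R x \<partial>M') \<le> ennreal e"
    by (rule uniformly_integrable_composition[OF sN sq _ fin(2) e(1)]) auto
  define d where "d = min e (min d1 d2)"
  have d: "0 < d" "d \<le> e" "d \<le> d1" "d \<le> d2" using e \<open>d1 > 0\<close> \<open>d2 > 0\<close> by (auto simp: d_def)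
  from exact_transport_in_probability[OF M N T conv d(1)] show ?thesis
  proof eventually_elim
    case (elim n)
    then obtain S where S [measurable]: "S \<in> borel_measurable borel" and SN: "distr M borel S = N"
      and close: "measure M {x. \<not> dist (S x) (T n x) < d} \<le> d" by blast
    note [measurable] = T[of n]
    let ?R = "{x. \<not> dist (S x) (T n x) < d}"
    have R [measurable]: "?R \<in> sets M" by (simp add: sM)
    have S': "S \<in> borel_measurable M" by measurable
    have tails: "(\<integral>\<^sup>+x. ennreal ((norm x)\<^sup>2) * indicator ?R x \<partial>M) \<le> ennreal e"
      "(\<integral>\<^sup>+x. ennreal ((norm (S x))\<^sup>2) * indicator ?R x \<partial>M) \<le> ennreal e"
      using d1[OF finite_measure_axioms _ _ R, of "\<lambda>x. x"] d2[OF finite_measure_axioms S' SN R] close d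
      by (auto simp: distr_id2 sM)
    have "monge_cost M T' \<le> monge_cost M S"
      using opt S SN by (auto simp: optimal_transport_map_def)
    also have "\<dots> \<le> (\<integral>\<^sup>+x. (ennreal (1 + e) * ennreal ((norm (x - T n x))\<^sup>2) + ennreal (e + e\<^sup>2)) +
        (2 * (ennreal ((norm x)\<^sup>2) * indicator ?R x) + 2 * (ennreal ((norm (S x))\<^sup>2) * indicator ?R x)) \<partial>M)"
      unfolding monge_cost_def
    proof (rule nn_integral_mono)
      fix x
      let ?a = "norm (x - T n x)"
      have *: "ennreal (1 + e) * ennreal (?a\<^sup>2) + ennreal (e + e\<^sup>2) = ennreal ((1 + e) * ?a\<^sup>2 + (e + e\<^sup>2))"
        using e by (simp add: ennreal_mult ennreal_plus)
      show "ennreal ((norm (x - S x))\<^sup>2) \<le> (ennreal (1 + e) * ennreal (?a\<^sup>2) + ennreal (e + e\<^sup>2)) +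
        (2 * (ennreal ((norm x)\<^sup>2) * indicator ?R x) + 2 * (ennreal ((norm (S x))\<^sup>2) * indicator ?R x))"
      proof (cases "x \<in> ?R")
        case True
        have "2 * ennreal ((norm x)\<^sup>2) + 2 * ennreal ((norm (S x))\<^sup>2) = ennreal (2 * (norm x)\<^sup>2 + 2 * (norm (S x))\<^sup>2)"
          by (simp add: ennreal_mult)
        then have "ennreal ((norm (x - S x))\<^sup>2) \<le> 2 * ennreal ((norm x)\<^sup>2) + 2 * ennreal ((norm (S x))\<^sup>2)"
          using norm_diff_square_le[of x "S x"] by (simp only: ennreal_leI)
        also have "\<dots> \<le> (ennreal (1 + e) * ennreal (?a\<^sup>2) + ennreal (e + e\<^sup>2)) + \<dots>"
          by (rule add_increasing) auto
        finally show ?thesis using True by simp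
      next
        case False
        then have "dist (S x) (T n x) < d" by simp
        then have "norm (x - S x) \<le> ?a + e"
          using d(2) dist_triangle[of x "S x" "T n x"] by (simp add: dist_norm norm_minus_commute)
        then have "(norm (x - S x))\<^sup>2 \<le> (?a + e)\<^sup>2" by (intro power_mono) auto
        \<comment> \<open>\<open>2 * ?a * e \<le> e * ?a\<^sup>2 + e\<close> trades the cross term for a relative error\<close>
        also have "(?a + e)\<^sup>2 = (1 + e) * ?a\<^sup>2 + (e + e\<^sup>2) - e * (?a - 1)\<^sup>2"
          by (simp add: power2_eq_square algebra_simps)
        also have "\<dots> \<le> (1 + e) * ?a\<^sup>2 + (e + e\<^sup>2)" using e by simp
        finally have "ennreal ((norm (x - S x))\<^sup>2) \<le> ennreal (1 + e) * ennreal (?a\<^sup>2) + ennreal (e + e\<^sup>2)"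
          unfolding * by (rule ennreal_leI)
        then show ?thesis using False by simp
      qed
    qed
    also have "\<dots> = (ennreal (1 + e) * monge_cost M (T n) + ennreal (e + e\<^sup>2)) +
        (2 * (\<integral>\<^sup>+x. ennreal ((norm x)\<^sup>2) * indicator ?R x \<partial>M) +
         2 * (\<integral>\<^sup>+x. ennreal ((norm (S x))\<^sup>2) * indicator ?R x \<partial>M))"
      unfolding monge_cost_def
      by (simp add: nn_integral_add nn_integral_cmult emeasure_space_1)
    also have "\<dots> \<le> (ennreal (1 + e) * monge_cost M (T n) + ennreal (e + e\<^sup>2)) + (2 * ennreal e + 2 * ennreal e)"
      using tails by (intro add_mono mult_left_mono order_refl) auto
    also have "\<dots> = ennreal (1 + e) * monge_cost M (T n) + ennreal (5 * e + e\<^sup>2)"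
      using e by (simp add: add.assoc ennreal_plus[symmetric] ennreal_mult'[symmetric] del: ennreal_plus flip: ennreal_numeral)
    also have "\<dots> \<le> ennreal (1 + e) * monge_cost M (T n) + ennreal (6 * e)"
      using e by (intro add_left_mono ennreal_leI) (simp add: power2_eq_square)
    finally show ?case .
  qed
qed

text \<open>
  Mass that \<open>T n\<close> sends to infinity may keep the costs strictly above the optimum, which is why
  only an inequality holds.
\<close>

proposition optimal_cost_le_liminf:
  fixes M N :: "'a::euclidean_space measure"
  assumes M: "M \<in> borel_prob" "null_slices M b" and N: "N \<in> borel_prob"
    and fin: "(\<integral>\<^sup>+x. ennreal ((norm x)\<^sup>2) \<partial>M) < \<infinity>" "(\<integral>\<^sup>+y. ennreal ((norm y)\<^sup>2) \<partial>N) < \<infinity>"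
    and T: "\<And>n. T n \<in> borel_measurable borel"
    and conv: "converges_weakly (\<lambda>n. distr M borel (T n)) N"
    and opt: "optimal_transport_map M N T'"
  shows "monge_cost M T' \<le> liminf (\<lambda>n. monge_cost M (T n))"
  unfolding le_Liminf_iff
proof (intro allI impI)
  fix y assume y: "y < monge_cost M T'"
  have "monge_cost M T' < \<infinity>"
    using opt fin M by (intro monge_cost_finite) (auto simp: optimal_transport_map_def borel_prob_def)
  then obtain m where m: "monge_cost M T' = ennreal m" "0 \<le> m"
    by (metis infinity_ennreal_def less_top_ennreal)
  then obtain z where z: "y = ennreal z" "0 \<le> z" "z < m"
    using y by (metis ennreal_less_iff less_top_ennreal order_less_trans top.not_eq_extremum ennreal_less_top)
  \<comment> \<open>so small that \<open>(1 + e) * z + 6 * e\<close>, the perturbed value of \<open>z\<close>, stays below the optimum \<open>m\<close>\<close>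
  define e where "e = min 1 ((m - z) / (2 * (z + 6)))"
  have e: "0 < e" "e \<le> 1" using z by (auto simp: e_def)
  have "e * (z + 6) \<le> (m - z) / (2 * (z + 6)) * (z + 6)"
    using z by (intro mult_right_mono) (auto simp: e_def)
  also have "\<dots> = (m - z) / 2" using z by (simp add: divide_simps)
  also have "\<dots> < m - z" using z by simp
  finally have less: "(1 + e) * z + 6 * e < m" by (simp add: algebra_simps)
  from optimal_cost_le_perturbed_cost[OF M N fin T conv opt e]
  show "\<forall>\<^sub>F n in sequentially. y < monge_cost M (T n)"
  proof eventually_elim
    case (elim n)
    show ?case
    proof (rule ccontr)
      assume "\<not> y < monge_cost M (T n)"
      then have "ennreal (1 + e) * monge_cost M (T n) + ennreal (6 * e) \<le> ennreal (1 + e) * ennreal z + ennreal (6 * e)"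
        using z(1) by (intro add_right_mono mult_left_mono) auto
      also have "\<dots> = ennreal ((1 + e) * z + 6 * e)"
        using e z by (simp add: ennreal_mult ennreal_plus)
      also have "\<dots> < ennreal m" using less z e by (intro ennreal_lessI) auto
      finally show False using elim m by simp
    qed
  qed
qed

section \<open>Penalized transport\<close>

lemma converges_weakly_if_metric_tendsto_0:
  assumes g: "metrizes_weak_topology g" and m: "\<And>n. m n \<in> borel_prob" "m0 \<in> borel_prob"
    and lim: "(\<lambda>n. g (m n) m0) \<longlonglongrightarrow> 0"
  shows "converges_weakly m m0"
proof -
  interpret Metric_space borel_prob g using g by (simp add: metrizes_weak_topology_def)
  have "limitin mtopology m m0 sequentially"
    unfolding limitin_metric using m order_tendstoD(2)[OF lim] by auto
  then show ?thesis
    using g limitin_weak_topology[OF m] by (simp add: metrizes_weak_topology_def)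
qed

theorem theorem2p1:
  fixes \<mu> \<nu> :: "(real ^ 'd) measure"
    and K :: "real ^ 'd \<Rightarrow> real ^ 'd \<Rightarrow> real"
    and \<epsilon> lam :: "nat \<Rightarrow> real"
    and T :: "nat \<Rightarrow> real ^ 'd \<Rightarrow> real ^ 'd"
    and Tstar :: "real ^ 'd \<Rightarrow> real ^ 'd"
  assumes "\<mu> \<in> borel_prob" and "\<nu> \<in> borel_prob"
    and "absolutely_continuous lborel \<mu>"
    and "(\<integral>\<^sup>+x. ennreal ((norm x)\<^sup>2) \<partial>\<mu>) + (\<integral>\<^sup>+y. ennreal ((norm y)\<^sup>2) \<partial>\<nu>) < \<infinity>"
    and "bounded (range (\<lambda>(x, y). K x y))"
    and "continuous_on UNIV (\<lambda>(x, y). K x y)"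
    and "strictly_positive_definite K"
    and "metrizes_weak_topology (mmd K)"
    and "\<And>n. \<epsilon> n > 0" and "\<epsilon> \<longlonglongrightarrow> 0"
    and "\<And>n. lam n > 0" and "filterlim lam at_top sequentially"
    and "\<And>n. T n \<in> borel_measurable borel"
    and "\<And>n. penalized_cost K \<mu> \<nu> (lam n) (T n) - ennreal (\<epsilon> n) \<le> penalized_inf K \<mu> \<nu> (lam n)"
    and "optimal_transport_map \<mu> \<nu> Tstar"
  shows "((\<lambda>n. sqrt (lam n) * mmd K (distr \<mu> borel (T n)) \<nu>) \<longlonglongrightarrow> 0) \<and>
         ((\<lambda>n. penalized_cost K \<mu> \<nu> (lam n) (T n)) \<longlonglongrightarrow> monge_cost \<mu> Tstar) \<and>
         converges_weakly (\<lambda>n. distr \<mu> borel (T n)) (distr \<mu> borel Tstar)"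
proof -
  note \<mu> = assms(1) and \<nu> = assms(2) and lam = assms(11) and T = assms(13) and opt = assms(15)
  interpret mmd: Metric_space borel_prob "mmd K"
    using assms(8) by (simp add: metrizes_weak_topology_def)
  have Tstar: "Tstar \<in> borel_measurable borel" "distr \<mu> borel Tstar = \<nu>"
    using opt by (auto simp: optimal_transport_map_def)
  have fin: "(\<integral>\<^sup>+x. ennreal ((norm x)\<^sup>2) \<partial>\<mu>) < \<infinity>" "(\<integral>\<^sup>+y. ennreal ((norm y)\<^sup>2) \<partial>\<nu>) < \<infinity>"
    using assms(4) by (auto simp: ennreal_add_less_top)
  obtain b :: "real ^ 'd" where "b \<in> Basis" using nonempty_Basis by blast
  then have slices: "null_slices \<mu> b" by (rule null_slices_absolutely_continuous[OF assms(3)])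
  have law: "distr \<mu> borel (T n) \<in> borel_prob" for n
    using \<mu> T[of n] by (auto simp: borel_prob_def intro!: prob_space.prob_space_distr cong: measurable_cong_sets)
  define \<gamma> where "\<gamma> n = mmd K (distr \<mu> borel (T n)) \<nu>" for n
  define G where "G n = lam n * (\<gamma> n)\<^sup>2" for n
  have G0: "0 \<le> G n" for n using lam[of n] by (simp add: G_def)
  have pen: "penalized_cost K \<mu> \<nu> (lam n) (T n) = monge_cost \<mu> (T n) + ennreal (G n)" for n
    by (simp add: penalized_cost_def G_def \<gamma>_def)
  \<comment> \<open>\<open>Tstar\<close> pays no penalty, so it bounds the penalized infimum\<close>
  have upper: "monge_cost \<mu> (T n) + ennreal (G n) \<le> monge_cost \<mu> Tstar + ennreal (\<epsilon> n)" for n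
  proof -
    have "penalized_inf K \<mu> \<nu> (lam n) \<le> penalized_cost K \<mu> \<nu> (lam n) Tstar"
      unfolding penalized_inf_def by (rule INF_lower) (rule Tstar)
    also have "\<dots> = monge_cost \<mu> Tstar"
      using mmd.mdist_zero[OF \<nu>] by (simp add: penalized_cost_def Tstar)
    finally show ?thesis
      using assms(14)[of n] by (metis pen ennreal_minus_le_iff add.commute order_trans)
  qed
  have "monge_cost \<mu> Tstar < \<infinity>"
    using fin \<mu> by (intro monge_cost_finite) (auto simp: Tstar borel_prob_def)
  then obtain m where m: "monge_cost \<mu> Tstar = ennreal m" "0 \<le> m"
    by (metis infinity_ennreal_def less_top_ennreal)
  have Gle: "G n \<le> m + \<epsilon> n" for n
  proof -
    have "ennreal (G n) \<le> monge_cost \<mu> (T n) + ennreal (G n)" by simp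
    also have "\<dots> \<le> ennreal (m + \<epsilon> n)"
      using upper[of n] m assms(9)[of n] by (simp add: ennreal_plus less_imp_le)
    finally show ?thesis
      using m assms(9)[of n] by (subst (asm) ennreal_le_iff) (auto intro: add_nonneg_nonneg less_imp_le)
  qed
  have "(\<lambda>n. (m + \<epsilon> n) / lam n) \<longlonglongrightarrow> 0"
    by (rule real_tendsto_divide_at_top[OF tendsto_add[OF tendsto_const assms(10)] assms(12)])
  then have "(\<lambda>n. (\<gamma> n)\<^sup>2) \<longlonglongrightarrow> 0"
  proof (rule real_tendsto_sandwich[OF _ _ tendsto_const, rotated 2])
    show "\<forall>\<^sub>F n in sequentially. (\<gamma> n)\<^sup>2 \<le> (m + \<epsilon> n) / lam n"
      using Gle lam by (intro always_eventually allI) (simp add: G_def field_simps)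
  qed simp
  then have "\<gamma> \<longlonglongrightarrow> 0" by simp
  then have weak: "converges_weakly (\<lambda>n. distr \<mu> borel (T n)) \<nu>"
    unfolding \<gamma>_def by (rule converges_weakly_if_metric_tendsto_0[OF assms(8) law \<nu>])
  have "((\<lambda>n. monge_cost \<mu> Tstar + ennreal (\<epsilon> n)) \<longlonglongrightarrow> monge_cost \<mu> Tstar + ennreal 0)"
    by (intro tendsto_add tendsto_const tendsto_ennrealI assms(10))
  then have upper_lim: "((\<lambda>n. monge_cost \<mu> Tstar + ennreal (\<epsilon> n)) \<longlonglongrightarrow> monge_cost \<mu> Tstar)" by simp
  \<comment> \<open>applied to the transport costs and to the penalized costs, whose difference is the penalty\<close>
  have squeeze: "F \<longlonglongrightarrow> monge_cost \<mu> Tstar"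
    if "\<And>n. monge_cost \<mu> (T n) \<le> F n" "\<And>n. F n \<le> monge_cost \<mu> Tstar + ennreal (\<epsilon> n)" for F
  proof (rule order_tendstoI)
    fix a assume "a < monge_cost \<mu> Tstar"
    then have "\<forall>\<^sub>F n in sequentially. a < monge_cost \<mu> (T n)"
      using optimal_cost_le_liminf[OF \<mu> slices \<nu> fin T weak opt] by (simp add: le_Liminf_iff)
    then show "\<forall>\<^sub>F n in sequentially. a < F n"
      by (rule eventually_mono) (rule less_le_trans[OF _ that(1)])
  next
    fix a assume "monge_cost \<mu> Tstar < a"
    from order_tendstoD(2)[OF upper_lim this] show "\<forall>\<^sub>F n in sequentially. F n < a"
      by (rule eventually_mono) (rule le_less_trans[OF that(2)])
  qed
  have lim_pen: "(\<lambda>n. monge_cost \<mu> (T n) + ennreal (G n)) \<longlonglongrightarrow> ennreal m"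
    unfolding m(1)[symmetric] by (rule squeeze) (auto intro: upper)
  have lim_cost: "(\<lambda>n. monge_cost \<mu> (T n)) \<longlonglongrightarrow> ennreal m"
    unfolding m(1)[symmetric]
    by (rule squeeze) (auto intro: order_trans[OF _ upper])
  have "monge_cost \<mu> (T n) < top" for n
  proof -
    have "monge_cost \<mu> (T n) \<le> ennreal m + ennreal (\<epsilon> n)"
      unfolding m(1)[symmetric] by (rule order_trans[OF _ upper]) simp
    then show ?thesis by (rule le_less_trans) simp
  qed
  then have "enn2real (monge_cost \<mu> (T n) + ennreal (G n)) - enn2real (monge_cost \<mu> (T n)) = G n" for n
    using G0 by (subst enn2real_plus) auto
  moreover have "(\<lambda>n. enn2real (monge_cost \<mu> (T n) + ennreal (G n)) - enn2real (monge_cost \<mu> (T n))) \<longlonglongrightarrow> m - m"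
    using m(2) by (intro tendsto_diff tendsto_enn2real lim_pen lim_cost)
  ultimately have "G \<longlonglongrightarrow> 0" by simp
  then have "(\<lambda>n. sqrt (G n)) \<longlonglongrightarrow> sqrt 0" by (rule tendsto_real_sqrt)
  moreover have "sqrt (G n) = sqrt (lam n) * \<gamma> n" for n
    by (simp add: G_def \<gamma>_def real_sqrt_mult)
  ultimately have "(\<lambda>n. sqrt (lam n) * mmd K (distr \<mu> borel (T n)) \<nu>) \<longlonglongrightarrow> 0"
    by (simp add: \<gamma>_def)
  with lim_pen weak show ?thesis
    by (simp add: pen m(1) Tstar)
qed

end
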